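(* Let $k\ge2$ and $N=d-k+1\ge0$. For $\mathbf s=(s_1,\dots,s_k)\in T_N^k$, $$E_{\mathbf s}=K_{G(k,N)}\bigl(1^{d-2k+1},\,1-s_k,\dots,1-s_2,\,1-s_1\bigr).$$
   Context: $T_N^k=\{(s_1,\dots,s_k)\in\mathbb Z_{\ge0}^k: s_1+\cdots+s_k=N\}$. $1^m$ denotes $m$ consecutive entries equal to $1$. For $k,m\ge1$, the distance graph $G(k,m)$ is the directed graph on vertex set $\{1,\dots,m\}$ with slack edges $(i,i+1)$ for $1\le i\le m-1$ and non-slack edges $(i,i+k)$ for $1\le i\le m-k$ (none if $m\le k$); $G(k,0)$ is the empty graph. An integral $\mathbf a$-flow on a directed graph on $\{1,\dots,m\}$ is an assignment of nonnegative integers $f_e$ to the edges such that at every vertex $i$ the total outgoing flow minus the total incoming flow equals $a_i$. The Kostant partition function $K_G(\mathbf a)$ is the number of integral $\mathbf a$-flows on $G$; on the empty graph there is exactly one integral flow, so the value is $1$. The net flow vector in the claim has one entry for each of the $N$ vertices of $G(k,N)$: the net flow at vertex $N-i$ is $1-s_{i+1}$ for $0\le i\le \min(k,N)-1$, and it is $1$ at the remaining vertices $1,\dots,N-k=d-2k+1$ (if $N<k$ there are no such remaining vertices, and only the last $N$ entries of the displayed vector are used). $k$-Entringer number: $E_{\mathbf s}$ is the number of integral flows on $G(k,d)$ with net flow $(1^{d-1},-d+1)$ whose flow on the slack edge $(d-k+1,d-k+2)$ is $s_1$ and whose flows on the last $k-1$ non-slack edges, read from right to left, are $s_2,\dots,s_k$;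 that is, the flow on $(N-i,N-i+k)$ is $s_{i+1}$ for $i=1,\dots,k-1$. If such an edge does not exist because its tail would be $\le0$ (small $N$), the flow on it is taken to be $0$. *)

theory Defs
  imports "Graph_Theory.Digraph"
begin

(* Arcs are named rather than identified with pairs of vertices: for k = 1 the slack and the
   non-slack arc leaving a vertex are parallel and must stay distinct. The argument is the tail. *)
datatype dist_arc = Slack nat | Nonslack nat

fun dist_tail :: "dist_arc \<Rightarrow> nat" where
  "dist_tail (Slack i) = i"
| "dist_tail (Nonslack i) = i"

fun dist_head :: "nat \<Rightarrow> dist_arc \<Rightarrow> nat" where
  "dist_head k (Slack i) = i + 1"
| "dist_head k (Nonslack i) = i + k"

definition distance_graph :: "nat \<Rightarrow> nat \<Rightarrow> (nat, dist_arc) pre_digraph" where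
  "distance_graph k m =
     \<lparr> verts = {1..m},
       arcs = {Slack i | i. 1 \<le> i \<and> i + 1 \<le> m} \<union> {Nonslack i | i. 1 \<le> i \<and> i + k \<le> m},
       tail = dist_tail,
       head = dist_head k \<rparr>"

(* A flow lives on the arcs of G only; it is extended by 0 to all other arc names, so that flows
   correspond one-to-one to these functions and a non-existent arc carries flow 0. *)
definition integral_flows :: "('v, 'e) pre_digraph \<Rightarrow> ('v \<Rightarrow> int) \<Rightarrow> ('e \<Rightarrow> nat) set" where
  "integral_flows G a =
     {f. (\<forall>e. e \<notin> arcs G \<longrightarrow> f e = 0) \<and>
         (\<forall>v \<in> verts G. (\<Sum>e \<in> out_arcs G v. int (f e)) - (\<Sum>e \<in> in_arcs G v. int (f e)) = a v)}"

(* Meaningful when there are finitely many flows, in particular for finite acyclic G such as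
   the distance graphs with k \<ge> 1. *)
definition kostant :: "('v, 'e) pre_digraph \<Rightarrow> ('v \<Rightarrow> int) \<Rightarrow> nat" where
  "kostant G a = card (integral_flows G a)"

(* The set T_N^k. Tuples (s_1, ..., s_k) are lists, so s_(i+1) is s ! i. *)
definition weak_compositions :: "nat \<Rightarrow> nat \<Rightarrow> nat list set" where
  "weak_compositions N k = {s. length s = k \<and> sum_list s = N}"

(* With N = d + 1 - k. When i \<ge> N, truncated subtraction gives the arc name Nonslack 0, which
   is not an arc of the graph and hence carries flow 0; likewise Slack 0 when N = 0. *)
definition entringer :: "nat \<Rightarrow> nat \<Rightarrow> nat list \<Rightarrow> nat" where
  "entringer k d s =
     card {f \<in> integral_flows (distance_graph k d) (\<lambda>v. if v < d then 1 else 1 - int d).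
             f (Slack (d + 1 - k)) = s ! 0 \<and>
             (\<forall>i \<in> {1..<k}. f (Nonslack (d + 1 - k - i)) = s ! i)}"

end

theory Submission
  imports Defs
begin

text \<open>
  Let \<open>N = d + 1 - k\<close>. Deleting the vertices after \<open>N\<close> from \<open>G(k,d)\<close> leaves \<open>G(k,N)\<close>. The deleted
  arcs that leave \<open>{1..N}\<close> are exactly those whose flow is prescribed by \<open>s\<close>, so moving their flow to
  the right-hand side changes the net flow at \<open>N - i\<close> from \<open>1\<close> to \<open>1 - s ! i\<close>. On the vertices after
  \<open>N\<close> only the slack arcs remain, and flow conservation determines them successively; the condition
  at the last vertex holds because \<open>s\<close> sums to \<open>N\<close>. If \<open>s\<close> prescribes a positive flow on an arc that
  does not exist, then both sides vanish: the net flow vector on \<open>G(k,N)\<close> has positive total.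
\<close>

section \<open>Flow conservation, in total and vertex by vertex on distance graphs\<close>

text \<open>Every arc has one tail and one head, so its flow enters the total once with each
  sign.\<close>

lemma (in fin_digraph) sum_netflow_eq_0:
  assumes "f \<in> integral_flows G a"
  shows "(\<Sum>v \<in> verts G. a v) = 0"
proof -
  have out: "(\<Sum>v \<in> verts G. \<Sum>e \<in> out_arcs G v. int (f e)) = (\<Sum>e \<in> arcs G. int (f e))"
    unfolding out_arcs_def by (rule sum.group) auto
  have inc: "(\<Sum>v \<in> verts G. \<Sum>e \<in> in_arcs G v. int (f e)) = (\<Sum>e \<in> arcs G. int (f e))"
    unfolding in_arcs_def by (rule sum.group) auto
  have "(\<Sum>v \<in> verts G. a v) =
      (\<Sum>v \<in> verts G. (\<Sum>e \<in> out_arcs G v. int (f e)) - (\<Sum>e \<in> in_arcs G v. int (f e)))"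
    using assms by (intro sum.cong) (auto simp: integral_flows_def)
  then show ?thesis
    by (simp add: sum_subtractf out inc)
qed

lemma fin_digraph_distance_graph: "fin_digraph (distance_graph k m)"
proof
  have "arcs (distance_graph k m) \<subseteq> Slack ` {..m} \<union> Nonslack ` {..m}"
    by (auto simp: distance_graph_def)
  then show "finite (arcs (distance_graph k m))"
    by (rule finite_subset) simp
qed (auto simp: distance_graph_def)

text \<open>
  The truncated differences \<open>v - 1\<close> and \<open>v - k\<close> give index \<open>0\<close>, hence flow \<open>0\<close>, for the missing
  incoming arcs.
\<close>

lemma integral_flows_distance_graph_iff:
  assumes "1 \<le> k"
  shows "f \<in> integral_flows (distance_graph k m) a \<longleftrightarrow>
    (\<forall>i. i = 0 \<or> m \<le> i \<longrightarrow> f (Slack i) = 0) \<and>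
    (\<forall>i. i = 0 \<or> m < i + k \<longrightarrow> f (Nonslack i) = 0) \<and>
    (\<forall>v \<in> {1..m}. int (f (Slack v)) + int (f (Nonslack v))
       - int (f (Slack (v - 1))) - int (f (Nonslack (v - k))) = a v)"
    (is "_ \<longleftrightarrow> ?S \<and> ?T \<and> (\<forall>v \<in> {1..m}. ?net v = a v)")
proof -
  let ?G = "distance_graph k m"
  have supp: "(\<forall>e. e \<notin> arcs ?G \<longrightarrow> f e = 0) \<longleftrightarrow> ?S \<and> ?T"
  proof
    assume *: "\<forall>e. e \<notin> arcs ?G \<longrightarrow> f e = 0"
    then show "?S \<and> ?T"
      by (auto simp: distance_graph_def)
  next
    assume *: "?S \<and> ?T"
    show "\<forall>e. e \<notin> arcs ?G \<longrightarrow> f e = 0"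
    proof (intro allI impI)
      fix e assume e: "e \<notin> arcs ?G"
      show "f e = 0"
      proof (cases e)
        case (Slack i)
        then show ?thesis
          using e *[THEN conjunct1, rule_format, of i] by (auto simp: distance_graph_def)
      next
        case (Nonslack i)
        then show ?thesis
          using e *[THEN conjunct2, rule_format, of i] by (auto simp: distance_graph_def)
      qed
    qed
  qed
  have net: "(\<Sum>e \<in> out_arcs ?G v. int (f e)) - (\<Sum>e \<in> in_arcs ?G v. int (f e)) = ?net v"
    if "v \<in> {1..m}" and f0: "\<forall>e. e \<notin> arcs ?G \<longrightarrow> f e = 0" for v
  proof -
    \<comment> \<open>Either named arc may be missing from the graph; \<open>f\<close> is 0 there by
      \<open>f0\<close>, so enlarging the index set is harmless.\<close>
    have "(\<Sum>e \<in> out_arcs ?G v. int (f e)) = (\<Sum>e \<in> {Slack v, Nonslack v}. int (f e))"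
      using that by (intro sum.mono_neutral_left) (auto simp: out_arcs_def distance_graph_def)
    moreover have
      "(\<Sum>e \<in> in_arcs ?G v. int (f e)) = (\<Sum>e \<in> {Slack (v - 1), Nonslack (v - k)}. int (f e))"
      using that assms by (intro sum.mono_neutral_left) (auto simp: in_arcs_def distance_graph_def)
    ultimately show ?thesis
      by simp
  qed
  have "f \<in> integral_flows ?G a \<longleftrightarrow> (?S \<and> ?T) \<and> (\<forall>v \<in> {1..m}. ?net v = a v)"
    unfolding integral_flows_def supp[symmetric] using net by (auto simp: distance_graph_def)
  then show ?thesis
    by simp
qed

section \<open>Cutting a flow off at \<open>N\<close>, and the candidate inverse\<close>

fun truncate_flow :: "nat \<Rightarrow> nat \<Rightarrow> (dist_arc \<Rightarrow> nat) \<Rightarrow> dist_arc \<Rightarrow> nat" where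
  "truncate_flow k N f (Slack i) = (if i < N then f (Slack i) else 0)"
| "truncate_flow k N f (Nonslack i) = (if i + k \<le> N then f (Nonslack i) else 0)"

text \<open>Closed form of the flow forced on the slack arc leaving \<open>v\<close>, for
  \<open>N \<le> v < d\<close>: the vertices \<open>N + 1, ..., v\<close> supply
  \<open>v - N\<close> units, \<open>s ! 0\<close> arrives on \<open>Slack N\<close>, and the sum
  collects the non-slack arcs ending at these vertices, since the one into \<open>N + t\<close>
  carries \<open>s ! (k - t)\<close>.\<close>

definition tail_slack :: "nat \<Rightarrow> nat \<Rightarrow> nat list \<Rightarrow> nat \<Rightarrow> nat" where
  "tail_slack k N s v = (v - N) + s ! 0 + (\<Sum>j = N + k - v..<k. s ! j)"

fun extend_flow :: "nat \<Rightarrow> nat \<Rightarrow> nat list \<Rightarrow> (dist_arc \<Rightarrow> nat) \<Rightarrow> dist_arc \<Rightarrow> nat" where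
  "extend_flow k N s g (Slack i) =
     (if i < N then g (Slack i) else if i + 1 < N + k then tail_slack k N s i else 0)"
| "extend_flow k N s g (Nonslack i) =
     (if i < N \<and> N < i + k then s ! (N - i) else g (Nonslack i))"

lemma tail_slack_start: "tail_slack k N s N = s ! 0"
  by (simp add: tail_slack_def)

lemma tail_slack_Suc:
  assumes "N \<le> v" "v + 1 < N + k"
  shows "tail_slack k N s (Suc v) = 1 + tail_slack k N s v + s ! (N + k - Suc v)"
proof -
  have "{N + k - Suc v..<k} = insert (N + k - Suc v) {N + k - v..<k}"
    using assms by auto
  then show ?thesis
    using assms by (simp add: tail_slack_def)
qed

text \<open>At \<open>d\<close> the sum contains every entry except \<open>s ! 0\<close>, so the
  value is \<open>N + (d - N)\<close>. It exceeds the inflow at \<open>d\<close> by one unit, so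
  that inflow is \<open>d - 1\<close>, as the net flow \<open>1 - d\<close> requires.\<close>

lemma tail_slack_end:
  assumes "2 \<le> k" "d + 1 = N + k" "s \<in> weak_compositions N k"
  shows "tail_slack k N s d = d"
proof -
  have "N = (\<Sum>j = 0..<k. s ! j)"
    using assms by (auto simp: weak_compositions_def sum_list_sum_nth)
  also have "\<dots> = s ! 0 + (\<Sum>j = 1..<k. s ! j)"
    using assms by (simp add: sum.atLeast_Suc_lessThan)
  finally have "N = s ! 0 + (\<Sum>j = 1..<k. s ! j)" .
  moreover have "N + k - d = 1"
    using assms by linarith
  ultimately show ?thesis
    using assms(1,2) by (simp add: tail_slack_def)
qed

section \<open>The two maps between the flow sets\<close>

definition entringer_flows :: "nat \<Rightarrow> nat \<Rightarrow> nat list \<Rightarrow> (dist_arc \<Rightarrow> nat) set" where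
  "entringer_flows k d s =
     {f \<in> integral_flows (distance_graph k d) (\<lambda>v. if v < d then 1 else 1 - int d).
        f (Slack (d + 1 - k)) = s ! 0 \<and>
        (\<forall>i \<in> {1..<k}. f (Nonslack (d + 1 - k - i)) = s ! i)}"

definition residual_netflow :: "nat \<Rightarrow> nat \<Rightarrow> nat list \<Rightarrow> nat \<Rightarrow> int" where
  "residual_netflow k N s v = (if N - v < k then 1 - int (s ! (N - v)) else 1)"

context
  fixes k N d :: nat and s :: "nat list"
  assumes k: "2 \<le> k" and d: "d + 1 = N + k"
begin

lemma entringer_flowsD:
  assumes "f \<in> entringer_flows k d s"
  shows "i = 0 \<or> d \<le> i \<Longrightarrow> f (Slack i) = 0"
    and "i = 0 \<or> N \<le> i \<Longrightarrow> f (Nonslack i) = 0"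
    and "1 \<le> v \<Longrightarrow> v \<le> d \<Longrightarrow> int (f (Slack v)) + int (f (Nonslack v))
       - int (f (Slack (v - 1))) - int (f (Nonslack (v - k))) = (if v < d then 1 else 1 - int d)"
    and "f (Slack N) = s ! 0"
    and "1 \<le> j \<Longrightarrow> j < k \<Longrightarrow> f (Nonslack (N - j)) = s ! j"
proof -
  have f: "f \<in> integral_flows (distance_graph k d) (\<lambda>v. if v < d then 1 else 1 - int d)"
    and s: "f (Slack N) = s ! 0" "\<forall>i \<in> {1..<k}. f (Nonslack (N - i)) = s ! i"
    using assms unfolding entringer_flows_def d by simp_all
  have "1 \<le> k"
    using k by simp
  note F = f[unfolded integral_flows_distance_graph_iff[OF this]]
  show "i = 0 \<or> d \<le> i \<Longrightarrow> f (Slack i) = 0"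
    using F[THEN conjunct1, rule_format] .
  show "f (Nonslack i) = 0" if "i = 0 \<or> N \<le> i"
  proof -
    have "i = 0 \<or> d < i + k"
      using that d by linarith
    then show ?thesis
      by (rule F[THEN conjunct2, THEN conjunct1, rule_format])
  qed
  show "1 \<le> v \<Longrightarrow> v \<le> d \<Longrightarrow> int (f (Slack v)) + int (f (Nonslack v))
       - int (f (Slack (v - 1))) - int (f (Nonslack (v - k))) = (if v < d then 1 else 1 - int d)"
    using F[THEN conjunct2, THEN conjunct2, rule_format, of v] by simp
  show "f (Slack N) = s ! 0" "1 \<le> j \<Longrightarrow> j < k \<Longrightarrow> f (Nonslack (N - j)) = s ! j"
    using s by auto
qed

lemma residual_flowsD:
  assumes "g \<in> integral_flows (distance_graph k N) (residual_netflow k N s)"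
  shows "i = 0 \<or> N \<le> i \<Longrightarrow> g (Slack i) = 0"
    and "i = 0 \<or> N < i + k \<Longrightarrow> g (Nonslack i) = 0"
    and "1 \<le> v \<Longrightarrow> v \<le> N \<Longrightarrow> int (g (Slack v)) + int (g (Nonslack v))
       - int (g (Slack (v - 1))) - int (g (Nonslack (v - k))) = residual_netflow k N s v"
  using assms k by (auto simp: integral_flows_distance_graph_iff)

text \<open>Past \<open>N\<close> no non-slack arc leaves a vertex, so conservation at
  \<open>Suc v\<close> becomes the recurrence of \<open>tail_slack\<close>.\<close>

lemma entringer_flow_Slack_eq_tail_slack:
  assumes f: "f \<in> entringer_flows k d s" and "N \<le> v" "v < d"
  shows "f (Slack v) = tail_slack k N s v"
  using \<open>N \<le> v\<close> \<open>v < d\<close>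
proof (induction v rule: dec_induct)
  case base
  then show ?case
    using entringer_flowsD(4)[OF f] by (simp add: tail_slack_start)
next
  case (step v)
  \<comment> \<open>This also holds for \<open>Suc v < k\<close>, where both truncated differences
    are 0 and name the absent arc \<open>Nonslack 0\<close>.\<close>
  have "N - (N + k - Suc v) = Suc v - k"
    using step d by auto
  then have "f (Nonslack (Suc v - k)) = s ! (N + k - Suc v)"
    using entringer_flowsD(5)[OF f, of "N + k - Suc v"] step d by auto
  moreover have "f (Nonslack (Suc v)) = 0"
    using entringer_flowsD(2)[OF f, of "Suc v"] step by simp
  moreover have "tail_slack k N s (Suc v) = 1 + tail_slack k N s v + s ! (N + k - Suc v)"
    using step d by (intro tail_slack_Suc) linarith+
  moreover have "int (f (Slack (Suc v))) + int (f (Nonslack (Suc v)))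
      - int (f (Slack v)) - int (f (Nonslack (Suc v - k))) = 1"
    using entringer_flowsD(3)[OF f, of "Suc v"] step.prems by simp
  ultimately show ?case
    using step by linarith
qed

lemma truncate_flow_mem:
  assumes f: "f \<in> entringer_flows k d s"
  shows "truncate_flow k N f \<in> integral_flows (distance_graph k N) (residual_netflow k N s)"
proof -
  note fD = entringer_flowsD[OF f]
  let ?g = "truncate_flow k N f"
  have "int (?g (Slack v)) + int (?g (Nonslack v)) - int (?g (Slack (v - 1)))
      - int (?g (Nonslack (v - k))) = residual_netflow k N s v" if v: "1 \<le> v" "v \<le> N" for v
  proof -
    have "?g (Nonslack (v - k)) = f (Nonslack (v - k))"
      using v fD(2)[of "v - k"] by (cases "k \<le> v") auto
    moreover have "v - 1 < N"
      using v by linarith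
    then have "?g (Slack (v - 1)) = f (Slack (v - 1))"
      by simp
    moreover have "int (?g (Slack v)) + int (?g (Nonslack v)) - residual_netflow k N s v
        = int (f (Slack v)) + int (f (Nonslack v)) - 1"
    \<comment> \<open>The incoming arcs of \<open>v\<close> all survive. Among the outgoing ones,
      only the slack arc can be lost at \<open>N\<close>, and only the non-slack arc at earlier
      vertices.\<close>
    proof (cases "v = N")
      case True
      then show ?thesis
        using fD(2)[of N] fD(4) k by (simp add: residual_netflow_def)
    next
      case False
      then show ?thesis
        using v fD(5)[of "N - v"] by (auto simp: residual_netflow_def)
    qed
    ultimately show ?thesis
      using fD(3)[of v] v k d by auto
  qed
  then show ?thesis
    using k fD(1,2) by (auto simp: integral_flows_distance_graph_iff)
qed

lemma extend_truncate_flow: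
  assumes f: "f \<in> entringer_flows k d s"
  shows "extend_flow k N s (truncate_flow k N f) = f"
proof
  fix e
  note fD = entringer_flowsD[OF f]
  show "extend_flow k N s (truncate_flow k N f) e = f e"
  proof (cases e)
    case (Slack i)
    then show ?thesis
      using entringer_flow_Slack_eq_tail_slack[OF f, of i] fD(1)[of i] d by auto
  next
    case (Nonslack i)
    then show ?thesis
      using fD(5)[of "N - i"] fD(2)[of i] by auto
  qed
qed

lemma truncate_extend_flow:
  assumes "g \<in> integral_flows (distance_graph k N) (residual_netflow k N s)"
  shows "truncate_flow k N (extend_flow k N s g) = g"
proof
  fix e
  show "truncate_flow k N (extend_flow k N s g) e = g e"
    using residual_flowsD(1,2)[OF assms] by (cases e) auto
qed

text \<open>The assumption \<open>zero\<close> concerns missing arcs: \<open>extend_flow\<close>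
  puts \<open>s ! N\<close> on \<open>Nonslack 0\<close> if \<open>0 < N < k\<close>, and
  \<open>s ! 0\<close> on \<open>Slack 0\<close> if \<open>N = 0\<close>, and these values must
  vanish.\<close>

lemma extend_flow_mem:
  assumes s: "s \<in> weak_compositions N k"
    and zero: "\<And>j. N \<le> j \<Longrightarrow> j < k \<Longrightarrow> s ! j = 0"
    and g: "g \<in> integral_flows (distance_graph k N) (residual_netflow k N s)"
  shows "extend_flow k N s g \<in> entringer_flows k d s"
proof -
  note gD = residual_flowsD[OF g]
  let ?f = "extend_flow k N s g"
  have S0: "?f (Slack i) = 0" if "i = 0 \<or> d \<le> i" for i
    using that zero[of 0] gD(1)[of i] d k tail_slack_start[of k N s] by auto
  have T0: "?f (Nonslack i) = 0" if "i = 0 \<or> N \<le> i" for i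
    using that zero[of N] gD(2)[of i] k by auto
  have T: "?f (Nonslack (N - j)) = s ! j" if "1 \<le> j" "j < k" for j
    using that zero[of j] T0[of 0] by (cases "j < N") auto
  have "int (?f (Slack v)) + int (?f (Nonslack v)) - int (?f (Slack (v - 1)))
      - int (?f (Nonslack (v - k))) = (if v < d then 1 else 1 - int d)"
    if v: "1 \<le> v" "v \<le> d" for v
  proof (cases "v \<le> N")
    case True
    have "?f (Nonslack (v - k)) = g (Nonslack (v - k))"
      using True v T0[of 0] gD(2)[of 0] by (cases "k \<le> v") auto
    moreover have "?f (Slack (v - 1)) = g (Slack (v - 1))"
      using True v by auto
    moreover have "int (?f (Slack v)) + int (?f (Nonslack v)) - 1
        = int (g (Slack v)) + int (g (Nonslack v)) - residual_netflow k N s v"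
      using True v gD(1)[of v] gD(2)[of v] k tail_slack_start[of k N s]
      by (cases "v = N") (auto simp: residual_netflow_def)
    ultimately show ?thesis
      using gD(3)[of v] True v k d by auto
  next
    case False
    then obtain u where u: "v = Suc u" "N \<le> u"
      by (metis Suc_leI Suc_le_D Suc_le_mono not_le)
    have "N - (N + k - v) = v - k"
      using v False d by auto
    then have "?f (Nonslack (v - k)) = s ! (N + k - v)"
      using T[of "N + k - v"] v False d k by auto
    moreover have "?f (Slack u) = tail_slack k N s u"
      using u v d by simp
    moreover have "?f (Nonslack v) = 0"
      using False by (intro T0) simp
    moreover have "tail_slack k N s v = 1 + tail_slack k N s u + s ! (N + k - v)"
      using tail_slack_Suc[of N u k s] u v d by simp
    \<comment> \<open>No slack arc leaves \<open>d\<close>. Replacing the formal value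
      \<open>d\<close> there by 0 turns net flow 1 into \<open>1 - d\<close>.\<close>
    moreover have "int (?f (Slack v)) = tail_slack k N s v - (if v < d then 0 else int d)"
      using tail_slack_end[OF k d s] S0[of v] False v d by auto
    ultimately show ?thesis
      using u by auto
  qed
  moreover have "?f (Nonslack i) = 0" if "i = 0 \<or> d < i + k" for i
    using that d by (intro T0) linarith
  moreover have "1 \<le> k"
    using k by simp
  ultimately have "?f \<in> integral_flows (distance_graph k d) (\<lambda>v. if v < d then 1 else 1 - int d)"
    using S0 by (simp add: integral_flows_distance_graph_iff del: extend_flow.simps)
  moreover have "?f (Slack N) = s ! 0"
    using k tail_slack_start[of k N s] by simp
  ultimately show ?thesis
    unfolding entringer_flows_def d using T by (simp del: extend_flow.simps)
qed

section \<open>Flow prescribed on missing arcs, and the final bijection\<close>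

text \<open>The total net flow, \<open>N\<close> minus the first \<open>N\<close> entries of
  \<open>s\<close>, must be 0, so these entries already exhaust the sum \<open>N\<close>.\<close>

lemma residual_flow_imp_nth_eq_0:
  assumes s: "s \<in> weak_compositions N k"
    and g: "g \<in> integral_flows (distance_graph k N) (residual_netflow k N s)"
    and j: "N \<le> j" "j < k"
  shows "s ! j = 0"
proof -
  interpret fin_digraph "distance_graph k N"
    by (rule fin_digraph_distance_graph)
  have "(\<Sum>v \<in> {1..N}. residual_netflow k N s v) = 0"
    using sum_netflow_eq_0[OF g] by (simp add: distance_graph_def)
  \<comment> \<open>Here \<open>N < k\<close>, so every vertex has net flow
    \<open>1 - s ! (N - v)\<close>.\<close>
  also have "(\<Sum>v \<in> {1..N}. residual_netflow k N s v) = (\<Sum>i \<in> {0..<N}. 1 - int (s ! i))"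
    by (rule sum.reindex_bij_witness[of _ "\<lambda>i. N - i" "\<lambda>v. N - v"])
      (use j in \<open>auto simp: residual_netflow_def\<close>)
  finally have "int (\<Sum>i \<in> {0..<N}. s ! i) = int N"
    by (simp add: sum_subtractf)
  moreover have "(\<Sum>i \<in> {0..<k}. s ! i) = N"
    using s by (auto simp: weak_compositions_def sum_list_sum_nth)
  moreover have "(\<Sum>i \<in> {0..<k}. s ! i) = (\<Sum>i \<in> {0..<N}. s ! i) + (\<Sum>i \<in> {N..<k}. s ! i)"
    using j by (simp add: sum.atLeastLessThan_concat)
  ultimately have "(\<Sum>i \<in> {N..<k}. s ! i) = 0"
    by linarith
  then show ?thesis
    using j by simp
qed

text \<open>Missing arcs need no separate case: any residual flow forces the corresponding entries
  of \<open>s\<close> to be 0, and without residual flows the inclusion for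
  \<open>extend_flow\<close> is vacuous.\<close>

lemma bij_betw_truncate_flow:
  assumes s: "s \<in> weak_compositions N k"
  shows "bij_betw (truncate_flow k N) (entringer_flows k d s)
    (integral_flows (distance_graph k N) (residual_netflow k N s))"
proof (rule bij_betw_byWitness[where f' = "extend_flow k N s"])
  show "extend_flow k N s ` integral_flows (distance_graph k N) (residual_netflow k N s)
      \<subseteq> entringer_flows k d s"
    using extend_flow_mem[OF s] residual_flow_imp_nth_eq_0[OF s] by blast
qed (auto simp: extend_truncate_flow truncate_extend_flow truncate_flow_mem)

end

theorem proposition6p5:
  fixes k d N :: nat and s :: "nat list"
  assumes "2 \<le> k"
    and "k \<le> d + 1"
    and "N = d + 1 - k"
    and "s \<in> weak_compositions N k"
  shows "entringer k d s =
         kostant (distance_graph k N) (\<lambda>v. if N - v < k then 1 - int (s ! (N - v)) else 1)"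
proof -
  have "d + 1 = N + k"
    using assms by simp
  from bij_betw_same_card[OF bij_betw_truncate_flow[OF assms(1) this assms(4)]]
  show ?thesis
    unfolding entringer_def kostant_def entringer_flows_def residual_netflow_def .
qed

end
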